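(* Let $S$ be a preordered set, let $\mathcal{O}S$ be the frame of upsets of $S$, let $N(\mathcal{O}S)$ be the frame of nuclei of $\mathcal{O}S$, and let $S_0$ be the skeleton of $S$. The following are equivalent. (1) $N(\mathcal{O}S)$ is not spatial. (2) The infinite binary tree $\mathscr{T}_2$ is isomorphic to a subposet of $S_0$. (3) $\mathscr{T}_2$ embeds isomorphically into $S$, i.e., there is an injective map $f:\mathscr{T}_2\to S$ such that for all $t,t'\in\mathscr{T}_2$, $t\le t'$ if and only if $f(t)\le f(t')$.
   Context: A preordered set is a set with a reflexive transitive relation $\le$; preordered sets correspond to Alexandroff spaces via the specialization preorder ($s\le t$ iff $s\in\overline{\{t\}}$), with open sets being exactly the upsets (subsets $U$ such that $s\in U$ and $s\le t$ imply $t\in U$). $\mathcal{O}S$ is the set of upsets of $S$ ordered by inclusion. The skeleton of $S$ is the poset $S_0=S/{\sim}$, where $x\sim y$ iff $x\le y$ and $y\le x$, ordered by $[x]\le_0[y]$ iff $x\le y$. A nucleus on a frame $L$ is a map $j:L\to L$ with $a\le j(a)$, $j(j(a))=j(a)$, and $j(a\wedge b)=j(a)\wedge j(b)$ for all $a,b\in L$; the set $N(L)$ of nuclei on $L$, ordered pointwise, is a frame. A frame is spatial if it is isomorphic to the frame of open sets of some topological space. The infinite binary tree $\mathscr{T}_2$ is the poset of all finite sequences of elements of $\{0,1\}$ ordered by the initial-segment (prefix) relation; its root, the empty sequence, is its least element. A subposet is a subset with the induced order. *)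

theory Defs
  imports "HOL-Algebra.Lattice" "HOL-Analysis.Abstract_Topology" "HOL-Library.Sublist"
begin

definition order_iso ::
    "('a, 'm) gorder_scheme \<Rightarrow> ('b, 'n) gorder_scheme \<Rightarrow> ('a \<Rightarrow> 'b) \<Rightarrow> bool" where
  "order_iso A B f \<longleftrightarrow> bij_betw f (carrier A) (carrier B) \<and>
     (\<forall>x\<in>carrier A. \<forall>y\<in>carrier A. x \<sqsubseteq>\<^bsub>A\<^esub> y \<longleftrightarrow> f x \<sqsubseteq>\<^bsub>B\<^esub> f y)"

definition opens :: "'p topology \<Rightarrow> 'p set gorder" where
  "opens X = \<lparr>carrier = {U. openin X U}, eq = (=), le = (\<subseteq>)\<rparr>"

text \<open>
  An order isomorphism between frames preserves all meets and joins, so it is a frame isomorphism.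
  HOL cannot quantify over the type of points; taking the points in the type of the elements of the
  frame is no restriction, as \<open>spatialI\<close> shows for a topological space on an arbitrary type.
\<close>

definition spatial :: "('a, 'm) gorder_scheme \<Rightarrow> bool" where
  "spatial L \<longleftrightarrow> (\<exists>(X :: 'a topology) f. order_iso L (opens X) f)"

lemma spatialI:
  fixes L :: "('a, 'm) gorder_scheme" and X :: "'p topology"
  assumes iso: "order_iso L (opens X) f"
  shows "spatial L"
proof -
  let ?O = "{U. openin X U}"
  have bij: "bij_betw f (carrier L) ?O"
    and le: "\<And>a b. a \<in> carrier L \<Longrightarrow> b \<in> carrier L \<Longrightarrow> a \<sqsubseteq>\<^bsub>L\<^esub> b \<longleftrightarrow> f a \<subseteq> f b"
    using iso by (auto simp: order_iso_def opens_def)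
  define m where "m x = \<Union>{U. openin X U \<and> x \<notin> U}" for x
  have openm: "openin X (m x)" for x
    unfolding m_def by blast
  have m_iff: "x \<in> U \<longleftrightarrow> \<not> U \<subseteq> m x" if "openin X U" for x U
    using that unfolding m_def by blast
  define p where "p x = inv_into (carrier L) f (m x)" for x
  have p_eq: "m x = m y" if "p x = p y" for x y
  proof -
    have "f (p x) = m x" "f (p y) = m y"
      using openm bij unfolding p_def
      by (auto simp: bij_betw_def intro!: f_inv_into_f)
    then show ?thesis using that by simp
  qed
  have p_mem: "p x \<in> p ` U \<longleftrightarrow> x \<in> U" if "openin X U" for x U
  proof
    assume "p x \<in> p ` U"
    then obtain y where "y \<in> U" "m x = m y" using p_eq by blast
    then show "x \<in> U" using m_iff[OF that] by simp
  qed blast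
  define T where "T V \<longleftrightarrow> (\<exists>U. openin X U \<and> V = p ` U)" for V
  have T: "istopology T"
    unfolding istopology_def
  proof (intro conjI allI impI)
    fix V W assume "T V" "T W"
    then obtain A B where AB: "openin X A" "V = p ` A" "openin X B" "W = p ` B"
      unfolding T_def by blast
    have "V \<inter> W = p ` (A \<inter> B)"
      unfolding AB(2,4) using p_mem[OF AB(1)] p_mem[OF AB(3)] by blast
    then show "T (V \<inter> W)"
      using AB unfolding T_def by blast
  next
    fix K assume K: "\<forall>V\<in>K. T V"
    have "\<Union>K = p ` \<Union>{U. openin X U \<and> p ` U \<in> K}"
    proof
      show "\<Union>K \<subseteq> p ` \<Union>{U. openin X U \<and> p ` U \<in> K}"
      proof
        fix v assume "v \<in> \<Union>K"
        then obtain V where V: "V \<in> K" "v \<in> V" by blast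
        then obtain U where "openin X U" "V = p ` U" using K unfolding T_def by blast
        then show "v \<in> p ` \<Union>{U. openin X U \<and> p ` U \<in> K}" using V by blast
      qed
    qed blast
    moreover have "openin X (\<Union>{U. openin X U \<and> p ` U \<in> K})"
      by (rule openin_Union) simp
    ultimately show "T (\<Union>K)" unfolding T_def by metis
  qed
  have img: "p ` U \<subseteq> p ` V \<longleftrightarrow> U \<subseteq> V" if "openin X U" "openin X V" for U V
    using p_mem[OF that(2)] by blast
  have "order_iso L (opens (topology T)) (\<lambda>a. p ` f a)"
    unfolding order_iso_def
  proof (intro conjI ballI)
    have "bij_betw ((`) p) ?O {V. T V}"
    proof (rule bij_betw_imageI)
      show "inj_on ((`) p) ?O"
      proof (rule inj_onI)
        fix U V assume "U \<in> ?O" "V \<in> ?O" "p ` U = p ` V"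
        then show "U = V" using img[of U V] img[of V U] by simp
      qed
      show "(`) p ` ?O = {V. T V}"
        unfolding T_def by blast
    qed
    from bij_betw_trans[OF bij this]
    show "bij_betw (\<lambda>a. p ` f a) (carrier L) (carrier (opens (topology T)))"
      using T by (simp add: opens_def comp_def)
  next
    fix a b assume ab: "a \<in> carrier L" "b \<in> carrier L"
    then have "openin X (f a)" "openin X (f b)"
      using bij by (auto simp: bij_betw_def)
    then show "a \<sqsubseteq>\<^bsub>L\<^esub> b \<longleftrightarrow> p ` f a \<sqsubseteq>\<^bsub>opens (topology T)\<^esub> p ` f b"
      using le[OF ab] img by (simp add: opens_def)
  qed
  then show ?thesis unfolding spatial_def by blast
qed

text \<open>Extensionality makes nuclei, as maps on the carrier, equal whenever they agree there.\<close>

definition nucleus :: "('a, 'm) gorder_scheme \<Rightarrow> ('a \<Rightarrow> 'a) \<Rightarrow> bool" where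
  "nucleus L j \<longleftrightarrow> j \<in> carrier L \<rightarrow>\<^sub>E carrier L \<and>
     (\<forall>a\<in>carrier L. a \<sqsubseteq>\<^bsub>L\<^esub> j a \<and> j (j a) = j a) \<and>
     (\<forall>a\<in>carrier L. \<forall>b\<in>carrier L. j (a \<sqinter>\<^bsub>L\<^esub> b) = j a \<sqinter>\<^bsub>L\<^esub> j b)"

definition nuclei :: "('a, 'm) gorder_scheme \<Rightarrow> ('a \<Rightarrow> 'a) gorder" where
  "nuclei L = \<lparr>carrier = {j. nucleus L j}, eq = (=),
     le = (\<lambda>j k. \<forall>a\<in>carrier L. j a \<sqsubseteq>\<^bsub>L\<^esub> k a)\<rparr>"

definition upsets :: "'a set \<Rightarrow> 'a rel \<Rightarrow> 'a set gorder" where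
  "upsets S r = \<lparr>carrier = {U. U \<subseteq> S \<and> (\<forall>s\<in>U. \<forall>t\<in>S. (s, t) \<in> r \<longrightarrow> t \<in> U)},
     eq = (=), le = (\<subseteq>)\<rparr>"

lemma meet_upsets:
  assumes "U \<in> carrier (upsets S r)" "V \<in> carrier (upsets S r)"
  shows "U \<sqinter>\<^bsub>upsets S r\<^esub> V = U \<inter> V"
proof -
  have le: "X \<sqsubseteq>\<^bsub>upsets S r\<^esub> Y \<longleftrightarrow> X \<subseteq> Y" for X Y
    by (simp add: upsets_def)
  have "U \<inter> V \<in> carrier (upsets S r)"
    using assms unfolding upsets_def by auto
  then have "greatest (upsets S r) (U \<inter> V) (Lower (upsets S r) {U, V})"
    using assms by (intro greatest_LowerI) (auto simp: Lower_def le)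
  moreover have "W = W'" if "greatest (upsets S r) W A" "greatest (upsets S r) W' A" for W W' A
    using greatest_le[OF that(1) greatest_mem[OF that(2)]]
      greatest_le[OF that(2) greatest_mem[OF that(1)]]
    by (simp add: le)
  ultimately show ?thesis
    unfolding meet_def inf_def by (metis someI)
qed

definition skeleton :: "'a set \<Rightarrow> 'a rel \<Rightarrow> 'a set gorder" where
  "skeleton S r = \<lparr>carrier = S // (r \<inter> r\<inverse>), eq = (=),
     le = (\<lambda>X Y. \<exists>x\<in>X. \<exists>y\<in>Y. (x, y) \<in> r)\<rparr>"

lemma skeleton_le_iff:
  assumes "preorder_on S r" "x \<in> S" "y \<in> S"
  shows "(r \<inter> r\<inverse>) `` {x} \<sqsubseteq>\<^bsub>skeleton S r\<^esub> (r \<inter> r\<inverse>) `` {y} \<longleftrightarrow> (x, y) \<in> r"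
proof
  have tr: "\<And>a b c. (a, b) \<in> r \<Longrightarrow> (b, c) \<in> r \<Longrightarrow> (a, c) \<in> r"
    using assms(1) unfolding preorder_on_def trans_def by blast
  assume "(r \<inter> r\<inverse>) `` {x} \<sqsubseteq>\<^bsub>skeleton S r\<^esub> (r \<inter> r\<inverse>) `` {y}"
  then obtain a b where "(x, a) \<in> r" "(a, b) \<in> r" "(b, y) \<in> r"
    unfolding skeleton_def by auto
  then show "(x, y) \<in> r" using tr by blast
next
  have "(x, x) \<in> r" "(y, y) \<in> r"
    using assms unfolding preorder_on_def refl_on_def by blast+
  moreover assume "(x, y) \<in> r"
  ultimately show "(r \<inter> r\<inverse>) `` {x} \<sqsubseteq>\<^bsub>skeleton S r\<^esub> (r \<inter> r\<inverse>) `` {y}"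
    unfolding skeleton_def by auto
qed

definition binary_tree :: "bool list gorder" where
  "binary_tree = \<lparr>carrier = UNIV, eq = (=), le = prefix\<rparr>"

end

theory Submission
  imports Defs
begin

text \<open>
  A nucleus \<open>j\<close> on the upsets of \<open>S\<close> is determined by points if for every fixed upset \<open>a\<close> and every
  \<open>y \<notin> a\<close> some prime fixed upset contains \<open>a\<close> but not \<open>y\<close>. The frame of nuclei is spatial iff this
  holds for all nuclei.

  If it fails for \<open>y\<close> and \<open>a\<close>, then there are \<open>y\<^sub>0, y\<^sub>1 \<ge> y\<close> with
  \<open>y\<^sub>0 \<notin> j (a \<union> \<up>y\<^sub>1)\<close> and \<open>y\<^sub>1 \<notin> j (a \<union> \<up>y\<^sub>0)\<close>: otherwise the fixed upsets above \<open>a\<close> have linearly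
  ordered traces on \<open>\<up>y\<close>, and the implication \<open>\<up>y \<rightarrow> a\<close> is prime. The failure persists for the pairs
  \<open>(y\<^sub>0, j (a \<union> \<up>y\<^sub>1))\<close> and \<open>(y\<^sub>1, j (a \<union> \<up>y\<^sub>0))\<close>, and iteration embeds the binary tree.

  Conversely, an embedded binary tree yields the nucleus of double negation on the tree, which lies
  below no prime nucleus, because the complement of a prime upset is directed.
\<close>

section \<open>Upsets of a preordered set and nuclei on their frame\<close>

locale preordered =
  fixes S :: "'a set" and r :: "'a rel"
  assumes preorder: "preorder_on S r"
begin

abbreviation ups :: "'a set set" where
  "ups \<equiv> carrier (upsets S r)"

definition up_of :: "'a \<Rightarrow> 'a set" where
  "up_of x = {y \<in> S. (x, y) \<in> r}"

text \<open>Points of a frame correspond to its prime elements, and passing from a frame to its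
  nuclei adds no points up to bijection. Prime upsets can therefore serve as the points of the frame
  of nuclei.\<close>

definition prime_upset :: "'a set \<Rightarrow> bool" where
  "prime_upset p \<longleftrightarrow> p \<in> ups \<and> p \<noteq> S \<and> (\<forall>U\<in>ups. \<forall>V\<in>ups. U \<inter> V \<subseteq> p \<longrightarrow> U \<subseteq> p \<or> V \<subseteq> p)"

lemma refl: "x \<in> S \<Longrightarrow> (x, x) \<in> r"
  using preorder by (auto simp: preorder_on_def refl_on_def)

lemma trans: "(x, y) \<in> r \<Longrightarrow> (y, z) \<in> r \<Longrightarrow> (x, z) \<in> r"
  using preorder by (auto simp: preorder_on_def trans_def)

lemma ups_iff: "U \<in> ups \<longleftrightarrow> U \<subseteq> S \<and> (\<forall>s\<in>U. \<forall>t\<in>S. (s, t) \<in> r \<longrightarrow> t \<in> U)"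
  by (simp add: upsets_def)

lemma ups_subset: "U \<in> ups \<Longrightarrow> U \<subseteq> S"
  by (simp add: ups_iff)

lemma ups_mono: "U \<in> ups \<Longrightarrow> s \<in> U \<Longrightarrow> t \<in> S \<Longrightarrow> (s, t) \<in> r \<Longrightarrow> t \<in> U"
  by (auto simp: ups_iff)

lemma ups_Int: "U \<in> ups \<Longrightarrow> V \<in> ups \<Longrightarrow> U \<inter> V \<in> ups"
  and ups_Un: "U \<in> ups \<Longrightarrow> V \<in> ups \<Longrightarrow> U \<union> V \<in> ups"
  and ups_empty: "{} \<in> ups"
  and ups_top: "S \<in> ups"
  by (auto simp: ups_iff)

lemma up_of_ups: "up_of x \<in> ups"
  by (auto simp: ups_iff up_of_def intro: trans)

lemma up_of_self: "x \<in> S \<Longrightarrow> x \<in> up_of x"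
  by (simp add: up_of_def refl)

lemma up_of_subset: "U \<in> ups \<Longrightarrow> x \<in> U \<Longrightarrow> up_of x \<subseteq> U"
  by (auto simp: up_of_def ups_iff)

lemma nucleus_iff:
  "nucleus (upsets S r) j \<longleftrightarrow> j \<in> ups \<rightarrow>\<^sub>E ups \<and> (\<forall>U\<in>ups. U \<subseteq> j U \<and> j (j U) = j U) \<and>
     (\<forall>U\<in>ups. \<forall>V\<in>ups. j (U \<inter> V) = j U \<inter> j V)"
proof -
  have le: "X \<sqsubseteq>\<^bsub>upsets S r\<^esub> Y \<longleftrightarrow> X \<subseteq> Y" for X Y
    by (simp add: upsets_def)
  have *: "(\<forall>U\<in>ups. \<forall>V\<in>ups. j (U \<sqinter>\<^bsub>upsets S r\<^esub> V) = j U \<sqinter>\<^bsub>upsets S r\<^esub> j V) \<longleftrightarrow>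
    (\<forall>U\<in>ups. \<forall>V\<in>ups. j (U \<inter> V) = j U \<inter> j V)" if "j \<in> ups \<rightarrow>\<^sub>E ups"
  proof -
    have "j U \<in> ups" if "U \<in> ups" for U
      using that \<open>j \<in> ups \<rightarrow>\<^sub>E ups\<close> by auto
    then show ?thesis by (simp add: meet_upsets)
  qed
  show ?thesis
    unfolding nucleus_def le by (intro conj_cong HOL.refl *)
qed

lemma nucleusI:
  assumes "\<And>U. U \<in> ups \<Longrightarrow> h U \<in> ups"
    and "\<And>U. U \<in> ups \<Longrightarrow> U \<subseteq> h U"
    and "\<And>U. U \<in> ups \<Longrightarrow> h (h U) \<subseteq> h U"
    and "\<And>U V. U \<in> ups \<Longrightarrow> V \<in> ups \<Longrightarrow> h (U \<inter> V) = h U \<inter> h V"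
  shows "nucleus (upsets S r) (restrict h ups)"
  unfolding nucleus_iff
proof (intro conjI ballI)
  show "restrict h ups \<in> ups \<rightarrow>\<^sub>E ups"
    using assms(1) by simp
  fix U assume U: "U \<in> ups"
  show "U \<subseteq> restrict h ups U"
    using assms(2) U by simp
  have "h (h U) = h U"
    using assms(2)[OF assms(1)[OF U]] assms(3)[OF U] by blast
  then show "restrict h ups (restrict h ups U) = restrict h ups U"
    using assms(1) U by simp
next
  fix U V assume "U \<in> ups" "V \<in> ups"
  then show "restrict h ups (U \<inter> V) = restrict h ups U \<inter> restrict h ups V"
    using assms(4) ups_Int by simp
qed

lemma
  assumes "nucleus (upsets S r) j" "U \<in> ups"
  shows nucleus_ups: "j U \<in> ups"
    and nucleus_incr: "U \<subseteq> j U"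
    and nucleus_idem: "j (j U) = j U"
    and nucleus_Int: "V \<in> ups \<Longrightarrow> j (U \<inter> V) = j U \<inter> j V"
proof -
  have j: "j \<in> ups \<rightarrow>\<^sub>E ups" "\<forall>U\<in>ups. U \<subseteq> j U \<and> j (j U) = j U"
    "\<forall>U\<in>ups. \<forall>V\<in>ups. j (U \<inter> V) = j U \<inter> j V"
    using iffD1[OF nucleus_iff assms(1)] by simp_all
  show "j U \<in> ups"
    by (rule PiE_mem[OF j(1) assms(2)])
  show "U \<subseteq> j U" "j (j U) = j U"
    using bspec[OF j(2) assms(2)] by simp_all
  show "j (U \<inter> V) = j U \<inter> j V" if "V \<in> ups"
    using j(3) assms(2) that by simp
qed

lemma nucleus_mono:
  assumes "nucleus (upsets S r) j" "U \<in> ups" "V \<in> ups" "U \<subseteq> V"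
  shows "j U \<subseteq> j V"
  using nucleus_Int[OF assms(1-3)] assms(4) by (simp add: Int_absorb2 le_iff_inf)

lemma nucleus_least:
  assumes "nucleus (upsets S r) j" "U \<in> ups" "V \<in> ups" "j V = V" "U \<subseteq> V"
  shows "j U \<subseteq> V"
  using nucleus_mono[OF assms(1-3,5)] assms(4) by simp

lemma nuclei_le: "j \<sqsubseteq>\<^bsub>nuclei (upsets S r)\<^esub> k \<longleftrightarrow> (\<forall>U\<in>ups. j U \<subseteq> k U)"
  by (simp add: nuclei_def upsets_def)

lemma nuclei_carrier: "carrier (nuclei (upsets S r)) = {j. nucleus (upsets S r) j}"
  by (simp add: nuclei_def)

lemma nucleus_meet:
  assumes j: "nucleus (upsets S r) j" and k: "nucleus (upsets S r) k"
  shows "nucleus (upsets S r) (\<lambda>U\<in>ups. j U \<inter> k U)"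
proof (rule nucleusI)
  fix U assume U: "U \<in> ups"
  note jU = nucleus_ups[OF j U] and kU = nucleus_ups[OF k U]
  show "j U \<inter> k U \<in> ups"
    by (rule ups_Int[OF jU kU])
  show "U \<subseteq> j U \<inter> k U"
    using nucleus_incr[OF j U] nucleus_incr[OF k U] by blast
  \<comment> \<open>\<open>j\<close> of the inner intersection is
    \<open>j U \<inter> j (k U)\<close>, which lies in \<open>j U\<close>; symmetrically for
    \<open>k\<close>.\<close>
  show "j (j U \<inter> k U) \<inter> k (j U \<inter> k U) \<subseteq> j U \<inter> k U"
    using nucleus_Int[OF j jU kU] nucleus_Int[OF k jU kU] nucleus_idem[OF j U] nucleus_idem[OF k U]
    by blast
next
  fix U V assume "U \<in> ups" "V \<in> ups"
  then show "j (U \<inter> V) \<inter> k (U \<inter> V) = j U \<inter> k U \<inter> (j V \<inter> k V)"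
    using nucleus_Int[OF j] nucleus_Int[OF k] by auto
qed

lemma nucleus_closed:
  assumes "A \<in> ups"
  shows "nucleus (upsets S r) (\<lambda>U\<in>ups. A \<union> U)"
  by (rule nucleusI) (use assms ups_Un in auto)

section \<open>Prime upsets and spatiality of the frame of nuclei\<close>

text \<open>A prime contains \<open>U \<inter> V\<close> iff it contains \<open>U\<close> or
  \<open>V\<close>, which makes this closure operator preserve binary meets. It supplies the joins
  of nuclei when the topology is built from primes.\<close>

lemma nucleus_primes:
  assumes "\<And>p. p \<in> Q \<Longrightarrow> prime_upset p"
  shows "nucleus (upsets S r) (\<lambda>U\<in>ups. {x \<in> S. \<forall>p\<in>Q. U \<subseteq> p \<longrightarrow> x \<in> p})"
proof (rule nucleusI)
  have Q: "p \<in> ups" if "p \<in> Q" for p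
    using assms[OF that] by (simp add: prime_upset_def)
  fix U assume U: "U \<in> ups"
  show "{x \<in> S. \<forall>p\<in>Q. U \<subseteq> p \<longrightarrow> x \<in> p} \<in> ups"
    using Q by (auto simp: ups_iff[of "Collect _"] intro: ups_mono)
  show "U \<subseteq> {x \<in> S. \<forall>p\<in>Q. U \<subseteq> p \<longrightarrow> x \<in> p}"
    using ups_subset[OF U] by blast
next
  fix U V assume UV: "U \<in> ups" "V \<in> ups"
  have "U \<inter> V \<subseteq> p \<longleftrightarrow> U \<subseteq> p \<or> V \<subseteq> p" if "p \<in> Q" for p
    using assms[OF that] UV unfolding prime_upset_def by blast
  then show "{x \<in> S. \<forall>p\<in>Q. U \<inter> V \<subseteq> p \<longrightarrow> x \<in> p} =
      {x \<in> S. \<forall>p\<in>Q. U \<subseteq> p \<longrightarrow> x \<in> p} \<inter> {x \<in> S. \<forall>p\<in>Q. V \<subseteq> p \<longrightarrow> x \<in> p}"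
    by auto
qed auto

text \<open>The hypothesis makes a nucleus determined by the primes it fixes, so the sets of moved
  primes form a topology isomorphic to the frame of nuclei.\<close>

lemma spatial_if_enough_primes:
  assumes enough: "\<And>j a y. nucleus (upsets S r) j \<Longrightarrow> a \<in> ups \<Longrightarrow> j a = a \<Longrightarrow> y \<in> S - a \<Longrightarrow>
    \<exists>p. prime_upset p \<and> j p = p \<and> a \<subseteq> p \<and> y \<notin> p"
  shows "spatial (nuclei (upsets S r))"
proof -
  \<comment> \<open>Moved rather than fixed primes, so that larger nuclei get larger open
    sets.\<close>
  define F where "F j = {p. prime_upset p \<and> j p \<noteq> p}" for j :: "'a set \<Rightarrow> 'a set"
  let ?N = "{j. nucleus (upsets S r) j}"
  have prime_ups: "p \<in> ups" if "prime_upset p" for p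
    using that by (simp add: prime_upset_def)
  have le: "(\<forall>U\<in>ups. j U \<subseteq> k U) \<longleftrightarrow> F j \<subseteq> F k" if j: "j \<in> ?N" and k: "k \<in> ?N" for j k
  proof
    assume jk: "\<forall>U\<in>ups. j U \<subseteq> k U"
    show "F j \<subseteq> F k"
    proof
      fix p assume "p \<in> F j"
      then have p: "prime_upset p" "j p \<noteq> p"
        unfolding F_def by blast+
      have "p \<subseteq> j p" "j p \<subseteq> k p"
        using nucleus_incr[of j p] j jk prime_ups[OF p(1)] by blast+
      then show "p \<in> F k"
        using p unfolding F_def by blast
    qed
  next
    assume F: "F j \<subseteq> F k"
    show "\<forall>U\<in>ups. j U \<subseteq> k U"
    proof (rule ballI, rule ccontr)
      fix U assume U: "U \<in> ups" and "\<not> j U \<subseteq> k U"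
      then obtain y where y: "y \<in> j U" "y \<notin> k U" by blast
      have "y \<in> S"
        using y(1) ups_subset nucleus_ups[of j U] j U by blast
      \<comment> \<open>A prime fixed by \<open>k\<close> separates \<open>y\<close> from
        \<open>k U\<close>; it is then fixed by \<open>j\<close> as well, which forces
        \<open>j U\<close> below it.\<close>
      then obtain p where p: "prime_upset p" "k p = p" "k U \<subseteq> p" "y \<notin> p"
        using enough[of k "k U" y] k U y(2) nucleus_ups[of k U] nucleus_idem[of k U] by blast
      then have "j p = p"
        using F unfolding F_def by blast
      moreover have "U \<subseteq> p"
        using p(3) nucleus_incr[of k U] k U by blast
      ultimately have "j U \<subseteq> p"
        using nucleus_least[of j U p] j U prime_ups[OF p(1)] by blast
      then show False using y(1) p(4) by blast
    qed
  qed
  have T: "istopology (\<lambda>V. V \<in> F ` ?N)"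
    unfolding istopology_def
  proof (intro conjI allI impI)
    fix V W assume "V \<in> F ` ?N" "W \<in> F ` ?N"
    then obtain j k where j: "j \<in> ?N" "V = F j" and k: "k \<in> ?N" "W = F k" by blast
    have "j p \<inter> k p = p \<longleftrightarrow> j p = p \<or> k p = p" if p: "prime_upset p" for p
    proof -
      have "p \<subseteq> j p" "p \<subseteq> k p" "j p \<in> ups" "k p \<in> ups"
        using j k prime_ups[OF p] nucleus_incr nucleus_ups by blast+
      moreover from this have "j p \<inter> k p \<subseteq> p \<longrightarrow> j p \<subseteq> p \<or> k p \<subseteq> p"
        using p unfolding prime_upset_def by blast
      ultimately show ?thesis by blast
    qed
    then have "V \<inter> W = F (\<lambda>U\<in>ups. j U \<inter> k U)"
      unfolding F_def j(2) k(2) using prime_ups by auto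
    moreover have "(\<lambda>U\<in>ups. j U \<inter> k U) \<in> ?N"
      using nucleus_meet j k by blast
    ultimately show "V \<inter> W \<in> F ` ?N" by blast
  next
    fix K assume K: "\<forall>V\<in>K. V \<in> F ` ?N"
    \<comment> \<open>The union of opens must move exactly the primes moved by some member of the
      family. So \<open>Q\<close> collects the primes fixed by all members, and \<open>l\<close>
      closes under them.\<close>
    define Q where "Q = {p. prime_upset p \<and> (\<forall>j\<in>?N. F j \<in> K \<longrightarrow> j p = p)}"
    define l where "l = (\<lambda>U\<in>ups. {x \<in> S. \<forall>p\<in>Q. U \<subseteq> p \<longrightarrow> x \<in> p})"
    have l: "l \<in> ?N"
      using nucleus_primes[of Q] unfolding l_def Q_def by blast
    have "l p = p \<longleftrightarrow> p \<in> Q" if p: "prime_upset p" for p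
    proof
      assume "p \<in> Q"
      then have "l p \<subseteq> p" unfolding l_def using prime_ups[OF p] by auto
      then show "l p = p" using nucleus_incr[of l p] l prime_ups[OF p] by blast
    next
      assume lp: "l p = p"
      \<comment> \<open>As \<open>p\<close> is the intersection of the members of \<open>Q\<close>
        above it, and \<open>j\<close> fixes each of them, \<open>j p\<close> stays below their
        intersection.\<close>
      have "j p = p" if j: "j \<in> ?N" "F j \<in> K" for j
      proof -
        have "j p \<subseteq> q" if "q \<in> Q" "p \<subseteq> q" for q
          using nucleus_least[of j p q] that j prime_ups p unfolding Q_def by blast
        moreover have "j p \<subseteq> S"
          using nucleus_ups[of j p] j prime_ups[OF p] ups_subset by blast
        ultimately have "j p \<subseteq> l p"
          unfolding l_def using prime_ups[OF p] by auto
        then show ?thesis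
          using lp nucleus_incr[of j p] j prime_ups[OF p] by blast
      qed
      then show "p \<in> Q" unfolding Q_def using p by blast
    qed
    then have Fl: "F l = {p. prime_upset p \<and> p \<notin> Q}"
      unfolding F_def by blast
    have "\<Union>K = F l"
    proof
      show "\<Union>K \<subseteq> F l"
        unfolding Fl using K unfolding Q_def F_def by fastforce
      show "F l \<subseteq> \<Union>K"
        unfolding Fl unfolding Q_def by (auto simp: F_def)
    qed
    then show "\<Union>K \<in> F ` ?N" using l by blast
  qed
  have "order_iso (nuclei (upsets S r)) (opens (topology (\<lambda>V. V \<in> F ` ?N))) F"
    unfolding order_iso_def
  proof (intro conjI ballI)
    have "inj_on F ?N"
    proof (rule inj_onI)
      fix j k assume jk: "j \<in> ?N" "k \<in> ?N" "F j = F k"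
      then have "j U = k U" if "U \<in> ups" for U
        using le[of j k] le[of k j] that by blast
      moreover have "j \<in> extensional ups" "k \<in> extensional ups"
        using jk by (auto simp: nucleus_iff PiE_def)
      ultimately show "j = k" by (rule extensionalityI[rotated 2])
    qed
    then show "bij_betw F (carrier (nuclei (upsets S r)))
        (carrier (opens (topology (\<lambda>V. V \<in> F ` ?N))))"
      by (simp add: nuclei_carrier opens_def topology_inverse'[OF T] bij_betw_def)
  next
    fix j k assume "j \<in> carrier (nuclei (upsets S r))" "k \<in> carrier (nuclei (upsets S r))"
    then show "j \<sqsubseteq>\<^bsub>nuclei (upsets S r)\<^esub> k \<longleftrightarrow>
        F j \<sqsubseteq>\<^bsub>opens (topology (\<lambda>V. V \<in> F ` ?N))\<^esub> F k"
      using le[of j k] unfolding nuclei_le nuclei_carrier by (simp add: opens_def)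
  qed
  then show ?thesis by (rule spatialI)
qed

text \<open>A nucleus other than the top one misses some point \<open>x\<close> of the space. The
  largest nucleus \<open>w\<close> missing \<open>x\<close> is prime among nuclei and lies above
  \<open>j\<close>; evaluating it at the empty upset gives the required prime.\<close>

lemma enough_primes_if_spatial:
  assumes "spatial (nuclei (upsets S r))"
    and j: "nucleus (upsets S r) j" and U: "U \<in> ups" "j U \<noteq> S"
  shows "\<exists>p. prime_upset p \<and> j p = p"
proof -
  let ?N = "{j. nucleus (upsets S r) j}"
  obtain X :: "('a set \<Rightarrow> 'a set) topology" and f
    where bij: "bij_betw f ?N {U. openin X U}"
      and le: "\<And>j k. j \<in> ?N \<Longrightarrow> k \<in> ?N \<Longrightarrow> (\<forall>U\<in>ups. j U \<subseteq> k U) \<longleftrightarrow> f j \<subseteq> f k"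
    using assms(1) unfolding spatial_def order_iso_def nuclei_le
    by (auto simp: nuclei_carrier opens_def)
  have opn: "openin X (f k)" if "k \<in> ?N" for k
    using bij that by (auto simp: bij_betw_def)
  have surj: "\<exists>k\<in>?N. f k = A" if "openin X A" for A
  proof -
    have "A \<in> f ` ?N"
      using bij that by (simp add: bij_betw_def)
    then show ?thesis by blast
  qed
  \<comment> \<open>Closed nuclei embed the frame of upsets into the frame of nuclei, with
    \<open>c S\<close> as the top nucleus.\<close>
  define c where "c A = (\<lambda>U\<in>ups. A \<union> U)" for A
  have c: "c A \<in> ?N" if "A \<in> ups" for A
    using nucleus_closed[OF that] by (simp add: c_def)
  have "\<not> c S U \<subseteq> j U"
    using U ups_subset nucleus_ups[OF j U(1)] by (auto simp: c_def)
  then obtain x where x: "x \<in> f (c S)" "x \<notin> f j"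
    using le[OF c[OF ups_top], of j] j U(1) by auto
  \<comment> \<open>The union of all opens missing \<open>x\<close> is open and misses
    \<open>x\<close>, so it comes from a largest such nucleus.\<close>
  obtain w where w: "w \<in> ?N" and fw: "f w = \<Union>{A. openin X A \<and> x \<notin> A}"
    using surj[of "\<Union>{A. openin X A \<and> x \<notin> A}"] by blast
  have below_w: "(\<forall>U\<in>ups. k U \<subseteq> w U) \<longleftrightarrow> x \<notin> f k" if "k \<in> ?N" for k
    using le[OF that w] opn[OF that] unfolding fw by blast
  have closed_below_w: "A \<subseteq> w {} \<longleftrightarrow> x \<notin> f (c A)" if A: "A \<in> ups" for A
  proof -
    have "A \<union> U \<subseteq> w U" if "A \<subseteq> w {}" "U \<in> ups" for U
      using that nucleus_mono[of w "{}" U] nucleus_incr[of w U] w ups_empty by blast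
    then have "A \<subseteq> w {} \<longleftrightarrow> (\<forall>U\<in>ups. c A U \<subseteq> w U)"
      using ups_empty by (auto simp: c_def)
    then show ?thesis using below_w[OF c[OF A]] by blast
  qed
  define p where "p = w {}"
  have p: "p \<in> ups"
    unfolding p_def using w nucleus_ups ups_empty by blast
  have "prime_upset p"
    unfolding prime_upset_def
  proof (intro conjI ballI impI)
    show "p \<noteq> S"
      using closed_below_w[OF ups_top] x(1) unfolding p_def by blast
    fix A B assume AB: "A \<in> ups" "B \<in> ups" "A \<inter> B \<subseteq> p"
    show "A \<subseteq> p \<or> B \<subseteq> p"
    proof (rule ccontr)
      assume "\<not> (A \<subseteq> p \<or> B \<subseteq> p)"
      then have xAB: "x \<in> f (c A) \<inter> f (c B)"
        using AB closed_below_w unfolding p_def by blast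
      obtain k where k: "k \<in> ?N" "f k = f (c A) \<inter> f (c B)"
        using surj[of "f (c A) \<inter> f (c B)"] opn c AB by blast
      then have "k V \<subseteq> c A V" "k V \<subseteq> c B V" if "V \<in> ups" for V
        using le[of k] c AB that by blast+
      \<comment> \<open>By distributivity, the meet of the closed nuclei of \<open>A\<close> and
        \<open>B\<close> is the closed nucleus of \<open>A \<inter> B\<close>.\<close>
      then have "\<forall>V\<in>ups. k V \<subseteq> c (A \<inter> B) V"
        by (fastforce simp: c_def)
      then have "f k \<subseteq> f (c (A \<inter> B))"
        using le[OF k(1) c] ups_Int AB by blast
      then show False
        using k(2) xAB AB closed_below_w[of "A \<inter> B"] ups_Int unfolding p_def by blast
    qed
  qed (fact p)
  moreover have "j p \<subseteq> w p"
    using below_w[of j] j x(2) p by blast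
  \<comment> \<open>Here \<open>w p = p\<close> by idempotence of \<open>w\<close>, and
    \<open>j\<close> lies below \<open>w\<close>.\<close>
  then have "j p = p"
    using nucleus_idem[of w "{}"] w ups_empty nucleus_incr[OF j p] unfolding p_def by auto
  ultimately show ?thesis by blast
qed

section \<open>An embedded tree excludes spatiality\<close>

lemma not_spatial_if_tree:
  assumes fS: "\<And>t. f t \<in> S" and f: "\<And>t t' :: bool list. prefix t t' \<longleftrightarrow> (f t, f t') \<in> r"
  shows "\<not> spatial (nuclei (upsets S r))"
proof
  assume sp: "spatial (nuclei (upsets S r))"
  \<comment> \<open>A point belongs to \<open>h U\<close> when the tree nodes above it all lie in
    the double negation, taken in the upsets of the tree, of the trace of \<open>U\<close>.\<close>
  define h where "h U = {s \<in> S. \<forall>t. (s, f t) \<in> r \<longrightarrow> (\<exists>t'. prefix t t' \<and> f t' \<in> U)}" for U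
  have hI: "s \<in> h U" if "s \<in> S" "\<And>t. (s, f t) \<in> r \<Longrightarrow> \<exists>t'. prefix t t' \<and> f t' \<in> U" for s U
    using that unfolding h_def by blast
  have hD: "\<exists>t'. prefix t t' \<and> f t' \<in> U" if "s \<in> h U" "(s, f t) \<in> r" for s U t
    using that unfolding h_def by blast
  have hS: "h U \<subseteq> S" for U
    unfolding h_def by blast
  have nuc: "nucleus (upsets S r) (restrict h ups)"
  proof (rule nucleusI)
    fix U assume U: "U \<in> ups"
    show "h U \<in> ups"
      unfolding h_def ups_iff by (blast intro: trans)
    show "U \<subseteq> h U"
    proof
      fix s assume "s \<in> U"
      then show "s \<in> h U"
        using ups_subset[OF U] ups_mono[OF U] fS by (intro hI) blast+
    qed
    show "h (h U) \<subseteq> h U"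
    proof
      fix s assume s: "s \<in> h (h U)"
      show "s \<in> h U"
      proof (rule hI)
        show "s \<in> S" using s hS by blast
        fix t assume "(s, f t) \<in> r"
        then obtain t' where t': "prefix t t'" "f t' \<in> h U"
          using hD[OF s] by blast
        then obtain t'' where "prefix t' t''" "f t'' \<in> U"
          using hD[of "f t'" U t'] refl[OF fS] by blast
        then show "\<exists>t'. prefix t t' \<and> f t' \<in> U"
          using t'(1) prefix_order.trans by blast
      qed
    qed
  next
    fix U V assume U: "U \<in> ups" and V: "V \<in> ups"
    show "h (U \<inter> V) = h U \<inter> h V"
    proof
      show "h (U \<inter> V) \<subseteq> h U \<inter> h V"
        unfolding h_def by blast
      show "h U \<inter> h V \<subseteq> h (U \<inter> V)"
      proof
        fix s assume s: "s \<in> h U \<inter> h V"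
        show "s \<in> h (U \<inter> V)"
        proof (rule hI)
          show "s \<in> S" using s hS by blast
          fix t assume st: "(s, f t) \<in> r"
          then obtain t' where t': "prefix t t'" "f t' \<in> U"
            using hD s by blast
          then have "(s, f t') \<in> r"
            using st f trans by blast
          then obtain t'' where t'': "prefix t' t''" "f t'' \<in> V"
            using hD s by blast
          then have "f t'' \<in> U"
            using ups_mono[OF U t'(2) fS] f by blast
          then show "\<exists>t'. prefix t t' \<and> f t' \<in> U \<inter> V"
            using t' t'' prefix_order.trans by blast
        qed
      qed
    qed
  qed
  \<comment> \<open>The root witnesses that the nucleus is not the top one, so it must fix a
    prime.\<close>
  have "f [] \<notin> h {}"
    using hD[of "f []" "{}" "[]"] refl[OF fS] by blast
  then have "restrict h ups {} \<noteq> S"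
    using fS ups_empty by auto
  then obtain p where p: "prime_upset p" and fixp: "restrict h ups p = p"
    using enough_primes_if_spatial[OF sp nuc ups_empty] by blast
  have "p \<in> ups" using p by (simp add: prime_upset_def)
  then have hp: "h p = p" using fixp by simp
  obtain x where x: "x \<in> S" "x \<notin> h p"
    using p ups_subset unfolding hp prime_upset_def by blast
  \<comment> \<open>Being outside a fixed upset of \<open>h\<close> yields a node \<open>t\<close>
    whose whole subtree avoids \<open>p\<close>.\<close>
  then obtain t where t: "\<And>t'. prefix t t' \<Longrightarrow> f t' \<notin> p"
    using hI[OF x(1), of p] x(2) by blast
  have nb: "\<not> up_of (f (t @ [b])) \<subseteq> p" for b
    using up_of_self[OF fS] t[of "t @ [b]"] by auto
  have "A \<subseteq> p \<or> B \<subseteq> p" if "A \<in> ups" "B \<in> ups" "A \<inter> B \<subseteq> p" for A B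
    using p that by (simp add: prime_upset_def)
  \<comment> \<open>Primality makes the complement of \<open>p\<close> directed: the two children of
    \<open>t\<close> have a common upper bound \<open>z\<close> outside \<open>p\<close>.\<close>
  then have "\<not> up_of (f (t @ [True])) \<inter> up_of (f (t @ [False])) \<subseteq> p"
    using nb up_of_ups by metis
  then obtain z where z: "z \<in> S" "(f (t @ [True]), z) \<in> r" "(f (t @ [False]), z) \<in> r" "z \<notin> h p"
    unfolding hp up_of_def by blast
  \<comment> \<open>Since \<open>z\<close> is outside \<open>h p\<close>, some tree node lies above
    it; that node would extend both children.\<close>
  obtain v where v: "(z, f v) \<in> r"
    using hI[OF z(1), of p] z(4) by blast
  have "prefix (t @ [True]) v" "prefix (t @ [False]) v"
    using z v trans f by blast+
  then show False
    by (auto simp: prefix_def)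
qed

section \<open>Growing a tree from a failure of separation\<close>

text \<open>These pairs are the states of the tree construction: \<open>y\<close> is the image of
  the current node, and \<open>a\<close> is a forbidden upset that no later node of the branch may
  enter.\<close>

definition unsplit :: "('a set \<Rightarrow> 'a set) \<Rightarrow> 'a \<times> 'a set \<Rightarrow> bool" where
  "unsplit j = (\<lambda>(y, a). a \<in> ups \<and> j a = a \<and> y \<in> S - a \<and>
     \<not> (\<exists>p. prime_upset p \<and> j p = p \<and> a \<subseteq> p \<and> y \<notin> p))"

lemma prime_imp:
  assumes j: "nucleus (upsets S r) j" and a: "a \<in> ups" "j a = a" and y: "y \<in> S - a"
    and linear: "\<And>u v. u \<in> up_of y \<Longrightarrow> v \<in> up_of y \<Longrightarrow> u \<in> j (a \<union> up_of v) \<or> v \<in> j (a \<union> up_of u)"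
  shows "\<exists>p. prime_upset p \<and> j p = p \<and> a \<subseteq> p \<and> y \<notin> p"
proof -
  \<comment> \<open>The Heyting implication from the principal upset of \<open>y\<close> to
    \<open>a\<close>; \<open>adj\<close> is its defining adjunction.\<close>
  define p where "p = {x \<in> S. up_of x \<inter> up_of y \<subseteq> a}"
  have p: "p \<in> ups"
    unfolding p_def ups_iff[of "Collect _"] up_of_def by (blast intro: trans)
  have adj: "V \<subseteq> p \<longleftrightarrow> V \<inter> up_of y \<subseteq> a" if V: "V \<in> ups" for V
  proof
    assume "V \<subseteq> p"
    then show "V \<inter> up_of y \<subseteq> a"
      using up_of_self ups_subset[OF V] unfolding p_def by blast
  next
    assume "V \<inter> up_of y \<subseteq> a"
    then show "V \<subseteq> p"
      using up_of_subset[OF V] ups_subset[OF V] unfolding p_def by blast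
  qed
  have ap: "a \<subseteq> p"
    using adj a by blast
  have yp: "y \<notin> p"
    using y up_of_self unfolding p_def by blast
  have upy: "up_of y \<subseteq> j (up_of y)"
    using nucleus_incr[OF j up_of_ups] .
  \<comment> \<open>An implication into a fixed upset is fixed, since \<open>j p\<close> meets the
    principal upset of \<open>y\<close> inside \<open>j a = a\<close>.\<close>
  have "j p \<inter> up_of y \<subseteq> j (p \<inter> up_of y)"
    using nucleus_Int[OF j p up_of_ups] upy by blast
  also have "\<dots> \<subseteq> a"
    using nucleus_least[OF j _ a] adj[OF p] ups_Int[OF p up_of_ups] by blast
  finally have "j p \<subseteq> p"
    using adj[OF nucleus_ups[OF j p]] by blast
  then have jp: "j p = p"
    using nucleus_incr[OF j p] by blast
  have "prime_upset p"
    unfolding prime_upset_def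
  proof (intro conjI ballI impI)
    show "p \<noteq> S" using y yp by blast
    fix U V assume U: "U \<in> ups" and V: "V \<in> ups" and UV: "U \<inter> V \<subseteq> p"
    show "U \<subseteq> p \<or> V \<subseteq> p"
    proof (rule ccontr)
      assume "\<not> (U \<subseteq> p \<or> V \<subseteq> p)"
      then have "\<not> U \<inter> up_of y \<subseteq> a" "\<not> V \<inter> up_of y \<subseteq> a"
        using adj[OF U] adj[OF V] by simp_all
      then obtain u v where u: "u \<in> U" "u \<in> up_of y" "u \<notin> a"
        and v: "v \<in> V" "v \<in> up_of y" "v \<notin> a"
        by blast
      have *: "u' \<notin> j (a \<union> up_of v')"
        if W: "U' \<in> ups" "V' \<in> ups" "U' \<inter> V' \<subseteq> p" and u': "u' \<in> U'" "u' \<in> up_of y" "u' \<notin> a"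
          and v': "v' \<in> V'" for U' V' u' v'
      proof
        assume "u' \<in> j (a \<union> up_of v')"
        \<comment> \<open>Above \<open>u'\<close>, adding the upset of \<open>v'\<close> to
          \<open>a\<close> contributes nothing new. Intersecting with the principal upset of
          \<open>u'\<close> before applying \<open>j\<close> thus puts \<open>u'\<close> into
          \<open>a\<close>.\<close>
        have sub: "(a \<union> up_of v') \<inter> up_of u' \<subseteq> a"
        proof -
          have "up_of u' \<inter> up_of v' \<subseteq> p \<inter> up_of y"
            using up_of_subset[OF W(1) u'(1)] up_of_subset[OF W(2) v'] W(3)
              up_of_subset[OF up_of_ups u'(2)] by blast
          then show ?thesis using adj[OF p] by blast
        qed
        have "u' \<in> S" using u'(2) by (simp add: up_of_def)
        then have "u' \<in> j (up_of u')"
          using up_of_self nucleus_incr[OF j up_of_ups] by blast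
        then have "u' \<in> j ((a \<union> up_of v') \<inter> up_of u')"
          using \<open>u' \<in> j (a \<union> up_of v')\<close> nucleus_Int[OF j ups_Un[OF a(1) up_of_ups] up_of_ups] by blast
        then have "u' \<in> a"
          using nucleus_least[OF j _ a sub] ups_Int ups_Un[OF a(1) up_of_ups] up_of_ups by blast
        then show False using u'(3) by blast
      qed
      show False
        using linear[OF u(2) v(2)] *[OF U V UV u v(1)] *[OF V U _ v u(1)] UV by blast
    qed
  qed (fact p)
  then show ?thesis using jp ap yp by blast
qed

text \<open>Non-linearity gives two points above \<open>y\<close>. Each child's forbidden upset is
  generated by the old one and its sibling, so it contains the sibling.\<close>

lemma unsplit_branch:
  assumes j: "nucleus (upsets S r) j" and "unsplit j (y, a)"
  obtains y0 a0 y1 a1 where "unsplit j (y0, a0)" "unsplit j (y1, a1)"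
    "(y, y0) \<in> r" "(y, y1) \<in> r" "a \<subseteq> a0" "a \<subseteq> a1" "y1 \<in> a0" "y0 \<in> a1"
proof -
  have a: "a \<in> ups" "j a = a" and y: "y \<in> S - a"
    and no: "\<not> (\<exists>p. prime_upset p \<and> j p = p \<and> a \<subseteq> p \<and> y \<notin> p)"
    using assms(2) unfolding unsplit_def by auto
  obtain u v where u: "u \<in> up_of y" "u \<notin> j (a \<union> up_of v)"
    and v: "v \<in> up_of y" "v \<notin> j (a \<union> up_of u)"
    using prime_imp[OF j a y] no by blast
  have uS: "u \<in> S" "(y, u) \<in> r" and vS: "v \<in> S" "(y, v) \<in> r"
    using u(1) v(1) by (auto simp: up_of_def)
  have a': "a \<union> up_of x \<in> ups" for x
    using ups_Un[OF a(1) up_of_ups] .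
  have sub: "a \<union> up_of x \<subseteq> j (a \<union> up_of x)" for x
    using nucleus_incr[OF j a'] .
  have uns: "unsplit j (x, j (a \<union> up_of x'))"
    if "x \<in> up_of y" "x \<notin> j (a \<union> up_of x')" for x x'
  proof -
    have "\<not> (\<exists>p. prime_upset p \<and> j p = p \<and> j (a \<union> up_of x') \<subseteq> p \<and> x \<notin> p)"
    proof
      assume "\<exists>p. prime_upset p \<and> j p = p \<and> j (a \<union> up_of x') \<subseteq> p \<and> x \<notin> p"
      then obtain p where p: "prime_upset p" "j p = p" "j (a \<union> up_of x') \<subseteq> p" "x \<notin> p" by blast
      \<comment> \<open>A prime omitting \<open>x\<close> omits everything below \<open>x\<close>,
        so separating the child would already separate \<open>y\<close> from
        \<open>a\<close>.\<close>
      have "y \<notin> p"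
        using p(1,4) that(1) ups_mono[of p y x] unfolding prime_upset_def up_of_def by blast
      then show False using no p sub by blast
    qed
    then show ?thesis
      using that nucleus_ups[OF j a'] nucleus_idem[OF j a'] unfolding unsplit_def up_of_def by blast
  qed
  show ?thesis
    by (rule that[OF uns[OF u] uns[OF v] uS(2) vS(2)])
      (use sub up_of_self uS vS in blast)+
qed

lemma tree_if_not_spatial:
  assumes "\<not> spatial (nuclei (upsets S r))"
  obtains f :: "bool list \<Rightarrow> 'a" where "\<And>t. f t \<in> S" "\<And>t t'. prefix t t' \<longleftrightarrow> (f t, f t') \<in> r"
proof -
  obtain j y a where j: "nucleus (upsets S r) j" and ya: "unsplit j (y, a)"
    using spatial_if_enough_primes assms unfolding unsplit_def by blast
  \<comment> \<open>\<open>g\<close> chooses both children of a state at once, which lets it relate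
    siblings; its values at other pairs are arbitrary.\<close>
  have "\<exists>g. \<forall>x. unsplit j x \<longrightarrow> (\<forall>b. unsplit j (g x b) \<and> (fst x, fst (g x b)) \<in> r \<and>
      snd x \<subseteq> snd (g x b) \<and> fst (g x b) \<in> snd (g x (\<not> b)))"
  proof (rule choice, rule allI)
    fix x
    show "\<exists>h. unsplit j x \<longrightarrow> (\<forall>b. unsplit j (h b) \<and> (fst x, fst (h b)) \<in> r \<and>
      snd x \<subseteq> snd (h b) \<and> fst (h b) \<in> snd (h (\<not> b)))"
    proof (cases "unsplit j x")
      case True
      then have "unsplit j (fst x, snd x)"
        by simp
      then obtain y0 a0 y1 a1 where "unsplit j (y0, a0)" "unsplit j (y1, a1)"
        "(fst x, y0) \<in> r" "(fst x, y1) \<in> r" "snd x \<subseteq> a0" "snd x \<subseteq> a1" "y1 \<in> a0" "y0 \<in> a1"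
        by (rule unsplit_branch[OF j])
      then show ?thesis
        by (intro exI[of _ "\<lambda>b. if b then (y1, a1) else (y0, a0)"]) auto
    qed blast
  qed
  then obtain g where *: "\<forall>x. unsplit j x \<longrightarrow> (\<forall>b. unsplit j (g x b) \<and> (fst x, fst (g x b)) \<in> r \<and>
      snd x \<subseteq> snd (g x b) \<and> fst (g x b) \<in> snd (g x (\<not> b)))"
    by (rule exE)
  have g: "unsplit j (g x b)" "(fst x, fst (g x b)) \<in> r" "snd x \<subseteq> snd (g x b)"
    "fst (g x b) \<in> snd (g x (\<not> b))" if "unsplit j x" for x b
    using mp[OF spec[OF *] that] by simp_all
  define st where "st = foldl g (y, a)"
  have st_snoc: "st (t @ [b]) = g (st t) b" for t b
    by (simp add: st_def)
  have uns: "unsplit j (st t)" for t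
    by (induction t rule: rev_induct) (use ya g(1) in \<open>auto simp: st_def\<close>)
  have st: "fst (st t) \<in> S" "fst (st t) \<notin> snd (st t)" "snd (st t) \<in> ups" for t
    using uns[of t] unfolding unsplit_def by (auto split: prod.splits)
  have mono: "(fst (st t), fst (st (t @ s))) \<in> r \<and> snd (st t) \<subseteq> snd (st (t @ s))" for t s
  proof (induction s rule: rev_induct)
    case Nil
    then show ?case using refl[OF st(1)] by simp
  next
    case (snoc b s)
    have "st (t @ s @ [b]) = g (st (t @ s)) b"
      using st_snoc[of "t @ s" b] by simp
    then show ?case
      using snoc g(2,3)[OF uns, of "t @ s" b] trans by auto
  qed
  \<comment> \<open>A child lies in the forbidden upset of its sibling, hence of every node in the
    sibling's subtree. A node of that subtree above the child would enter its own forbidden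
    upset.\<close>
  have apart: "(fst (st (t @ [b])), fst (st (t @ [\<not> b] @ s))) \<notin> r" for t b s
  proof
    assume "(fst (st (t @ [b])), fst (st (t @ [\<not> b] @ s))) \<in> r"
    moreover have "fst (st (t @ [b])) \<in> snd (st (t @ [\<not> b] @ s))"
      using g(4)[OF uns, of t b] mono[of "t @ [\<not> b]" s] by (auto simp: st_snoc)
    ultimately show False
      using ups_mono[OF st(3) _ st(1)] st(2) by blast
  qed
  have "prefix t t'" if le: "(fst (st t), fst (st t')) \<in> r" for t t'
  proof (rule ccontr)
    assume "\<not> prefix t t'"
    then consider "strict_prefix t' t" | "t \<parallel> t'"
      by (metis parallelI prefix_order.le_less)
    then show False
    proof cases
      case 1
      then obtain b s where t: "t = t' @ b # s"
        by (rule strict_prefixE')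
      \<comment> \<open>The child of \<open>t'\<close> towards \<open>t\<close> would lie below
        \<open>t'\<close>, and hence below its own sibling.\<close>
      have "(fst (st (t' @ [b])), fst (st t')) \<in> r"
        using mono[of "t' @ [b]" s] le t trans by auto
      then show False
        using apart[of t' b "[]"] mono[of t' "[\<not> b]"] trans by auto
    next
      case 2
      then obtain w b s c s' where "b \<noteq> c" and t: "t = w @ b # s" "t' = w @ c # s'"
        using parallel_decomp[OF 2] by blast
      then have "c = (\<not> b)" by blast
      \<comment> \<open>Where the branches part, the child towards \<open>t\<close> would lie below
        \<open>t'\<close>, a node of the other child's subtree.\<close>
      moreover have "(fst (st (w @ [b])), fst (st t')) \<in> r"
        using mono[of "w @ [b]" s] le t trans by auto
      ultimately show False
        using apart[of w b s'] t by auto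
    qed
  qed
  moreover have "(fst (st t), fst (st t')) \<in> r" if "prefix t t'" for t t'
    using that mono by (auto simp: prefix_def)
  ultimately show ?thesis
    using that[of "\<lambda>t. fst (st t)"] st(1) by blast
qed

section \<open>Passing between the skeleton and the preordered set\<close>

text \<open>Order between classes can be tested on representatives, so choosing representatives and
  taking classes both preserve and reflect the order.\<close>

lemma tree_in_skeleton_iff:
  "(\<exists>P f. P \<subseteq> carrier (skeleton S r) \<and> order_iso binary_tree ((skeleton S r)\<lparr>carrier := P\<rparr>) f) \<longleftrightarrow>
   (\<exists>f. (\<forall>t. f t \<in> S) \<and> (\<forall>t t' :: bool list. prefix t t' \<longleftrightarrow> (f t, f t') \<in> r))"
  (is "?L \<longleftrightarrow> ?R")
proof
  assume ?L
  then obtain P F where P: "P \<subseteq> carrier (skeleton S r)"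
    and iso: "order_iso binary_tree ((skeleton S r)\<lparr>carrier := P\<rparr>) F"
    by blast
  have F: "F t \<in> P" and le: "prefix t t' \<longleftrightarrow> F t \<sqsubseteq>\<^bsub>skeleton S r\<^esub> F t'" for t t'
    using iso by (auto simp: order_iso_def binary_tree_def bij_betw_def)
  have "F t \<in> S // (r \<inter> r\<inverse>)" for t
    using P F by (auto simp: skeleton_def)
  then have "\<forall>t. \<exists>x. x \<in> S \<and> F t = (r \<inter> r\<inverse>) `` {x}"
    by (metis quotientE)
  then obtain f where "\<And>t. f t \<in> S" "\<And>t. F t = (r \<inter> r\<inverse>) `` {f t}"
    by metis
  then show ?R
    using le skeleton_le_iff[OF preorder] by (intro exI[of _ f]) simp
next
  assume ?R
  then obtain f where f: "\<And>t. f t \<in> S" "\<And>t t' :: bool list. prefix t t' \<longleftrightarrow> (f t, f t') \<in> r"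
    by blast
  define F where "F t = (r \<inter> r\<inverse>) `` {f t}" for t
  have le: "F t \<sqsubseteq>\<^bsub>skeleton S r\<^esub> F t' \<longleftrightarrow> prefix t t'" for t t'
    unfolding F_def using skeleton_le_iff[OF preorder f(1) f(1)] f(2) by simp
  have "inj F"
    by (rule injI) (metis le prefix_order.order_refl prefix_order.antisym)
  then have "order_iso binary_tree ((skeleton S r)\<lparr>carrier := range F\<rparr>) F"
    using le by (simp add: order_iso_def binary_tree_def bij_betw_def)
  moreover have "range F \<subseteq> carrier (skeleton S r)"
    using f(1) by (auto simp: F_def skeleton_def intro: quotientI)
  ultimately show ?L by blast
qed

end

theorem corollary4p1:
  fixes S :: "'a set" and r :: "'a rel"
  assumes "preorder_on S r"
  shows
    "(\<not> spatial (nuclei (upsets S r)) \<longleftrightarrow>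
        (\<exists>P f. P \<subseteq> carrier (skeleton S r) \<and>
           order_iso binary_tree ((skeleton S r)\<lparr>carrier := P\<rparr>) f)) \<and>
     ((\<exists>P f. P \<subseteq> carrier (skeleton S r) \<and>
           order_iso binary_tree ((skeleton S r)\<lparr>carrier := P\<rparr>) f) \<longleftrightarrow>
        (\<exists>f. f \<in> carrier binary_tree \<rightarrow> S \<and> inj_on f (carrier binary_tree) \<and>
           (\<forall>t\<in>carrier binary_tree. \<forall>t'\<in>carrier binary_tree.
              t \<sqsubseteq>\<^bsub>binary_tree\<^esub> t' \<longleftrightarrow> (f t, f t') \<in> r)))"
proof -
  interpret preordered S r
    by (rule preordered.intro) (fact assms)
  \<comment> \<open>Equal values are related both ways by reflexivity on \<open>S\<close>, so
    antisymmetry of \<open>prefix\<close> applies.\<close>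
  have "inj f" if "\<And>t. f t \<in> S" "\<And>t t' :: bool list. prefix t t' \<longleftrightarrow> (f t, f t') \<in> r" for f
    by (rule injI) (metis that refl prefix_order.antisym)
  then have "(\<exists>f. f \<in> carrier binary_tree \<rightarrow> S \<and> inj_on f (carrier binary_tree) \<and>
      (\<forall>t\<in>carrier binary_tree. \<forall>t'\<in>carrier binary_tree.
        t \<sqsubseteq>\<^bsub>binary_tree\<^esub> t' \<longleftrightarrow> (f t, f t') \<in> r)) \<longleftrightarrow>
    (\<exists>f. (\<forall>t. f t \<in> S) \<and> (\<forall>t t' :: bool list. prefix t t' \<longleftrightarrow> (f t, f t') \<in> r))"
    by (simp add: binary_tree_def Pi_iff) blast
  moreover have "\<not> spatial (nuclei (upsets S r)) \<longleftrightarrow>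
    (\<exists>f. (\<forall>t. f t \<in> S) \<and> (\<forall>t t' :: bool list. prefix t t' \<longleftrightarrow> (f t, f t') \<in> r))"
    (is "_ \<longleftrightarrow> ?R")
  proof
    assume "\<not> spatial (nuclei (upsets S r))"
    then show ?R
      by (rule tree_if_not_spatial) blast
  next
    assume ?R
    then obtain f where "\<And>t. f t \<in> S" "\<And>t t' :: bool list. prefix t t' \<longleftrightarrow> (f t, f t') \<in> r"
      by blast
    then show "\<not> spatial (nuclei (upsets S r))"
      by (rule not_spatial_if_tree)
  qed
  ultimately show ?thesis
    unfolding tree_in_skeleton_iff by blast
qed

end
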